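(* Let $\mathcal{S}\subset\mathbb{Z}\times\mathbb{Z}$ be a finite set with nonzero weights $(w_s)_{s\in\mathcal{S}}$ in $\mathbb{C}$, assume that the Laurent polynomial $S(X,Y)=\sum_{s\in\mathcal{S}}w_sX^{s_x}Y^{s_y}$ is not univariate and that the orbit $\mathcal{O}$ of the walk is finite. Let $(\gamma_x,\gamma_y,\alpha)$ be a decoupling of $(x,y)$ in the orbit. Then a regular fraction $H(X,Y,t)\in\mathbb{C}(X,Y,t)$ admits a Galois decoupling if and only if $H_\alpha=0$, and in this case the decoupling is given by $H_{(x,y)}=H_{\gamma_x}+H_{\gamma_y}$, with $H_{\gamma_x}\in k(x)$ and $H_{\gamma_y}\in k(y)$.
   Context: Here $x,y$ are two indeterminates, $\mathbb{K}=\overline{\mathbb{C}(x,y)}$ is an algebraic closure of $\mathbb{C}(x,y)$, $k=\mathbb{C}(S(x,y))$, and $X,Y,t$ are further indeterminates. "Not univariate" means that both variables $X$ and $Y$ actually occur in $S(X,Y)$. Orbit: two pairs $(u,v),(u',v')\in\mathbb{K}\times\mathbb{K}$ are adjacent, written $\sim$, if $S(u,v)=S(u',v')$ and ($u=u'$ or $v=v'$); $\sim^*$ is the transitive closure of $\sim$. The orbit $\mathcal{O}$ is the set of pairs $(u,v)\in\mathbb{K}\times\mathbb{K}$ with $(u,v)\sim^*(x,y)$. The field $k(\mathcal{O})$ is the subfield of $\mathbb{K}$ generated over $k$ by the coordinates of all pairs in $\mathcal{O}$. Regular fractions: the kernel polynomial is $\widetilde{K}(X,Y,t)=X^{m_x}Y^{m_y}(1-tS(X,Y))$,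 where $m_x=\max(0,-\min_{s\in\mathcal{S}}s_x)$ and $m_y=\max(0,-\min_{s\in\mathcal{S}}s_y)$; it is irreducible in $\mathbb{C}[X,Y,t]$. A fraction $H(X,Y,t)\in\mathbb{C}(X,Y,t)$ (in lowest terms) is regular if its denominator is not divisible by $\widetilde{K}$. Evaluation: for a regular fraction $H$ and $(u,v)\in\mathcal{O}$, set $H_{(u,v)}=H(u,v,1/S(x,y))\in k(\mathcal{O})$. A $0$-chain is a (finite) formal $\mathbb{C}$-linear combination $c=\sum_{(u,v)\in\mathcal{O}}c_{u,v}(u,v)$ of pairs of the orbit, and $H_c=\sum_{(u,v)\in\mathcal{O}}c_{u,v}H_{(u,v)}$. The evaluation $H\mapsto H_{(x,y)}$ maps $\mathbb{C}(X,t)$ bijectively onto $k(x)$ and $\mathbb{C}(Y,t)$ bijectively onto $k(y)$. Galois decoupling: a regular fraction $H(X,Y,t)$ admits a Galois decoupling if there exist $F(X,t)\in\mathbb{C}(X,t)$ and $G(Y,t)\in\mathbb{C}(Y,t)$ such that $H_{(x,y)}=F_{(x,y)}+G_{(x,y)}$; equivalently, $H_{(x,y)}=f+g$ with $f\in k(x)$ and $g\in k(y)$. Decoupling of $(x,y)$ in the orbit: a triple of $0$-chains $(\gamma_x,\gamma_y,\alpha)$ with $(x,y)=\gamma_x+\gamma_y+\alpha$ (where $(x,y)$ is viewed as the $0$-chain given by the single vertex $(x,y)$) such that for every regular fraction $H(X,Y,t)$: (1) $H_{\gamma_x}\in k(x)$ and $H_{\gamma_y}\in k(y)$, and (2) $H_\alpha=0$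 whenever $H$ admits a Galois decoupling. *)

theory Defs
  imports
    "HOL-Algebra.Algebraic_Closure_Type"
    "HOL-Algebra.Generated_Fields"
    "HOL-Library.Poly_Mapping"
begin

section \<open>The ambient fields\<close>

text \<open>
  The ring of polynomials over the complex numbers in \<open>x, y\<close> is \<^typ>\<open>complex poly poly\<close>
  (inner variable \<open>x\<close>, outer variable \<open>y\<close>); \<open>KK\<close> is an algebraic closure of its
  fraction field.
\<close>

type_synonym KK = "complex poly poly fract alg_closure"

definition cK :: "complex \<Rightarrow> KK" where
  "cK a = to_ac (to_fract [:[:a:]:])"

definition xK :: KK where
  "xK = to_ac (to_fract [:[:0, 1:]:])"

definition yK :: KK where
  "yK = to_ac (to_fract [:0, 1:])"

text \<open>
  Polynomials in \<open>X, Y, t\<close> are \<^typ>\<open>complex poly poly poly\<close>, with \<open>X\<close> innermost and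
  \<open>t\<close> outermost.
\<close>

type_synonym pol3 = "complex poly poly poly"
type_synonym frac3 = "pol3 fract"

definition cP :: "complex \<Rightarrow> pol3" where
  "cP a = [:[:[:a:]:]:]"

definition XP :: pol3 where
  "XP = [:[:[:0, 1:]:]:]"

definition YP :: pol3 where
  "YP = [:[:0, 1:]:]"

definition tP :: pol3 where
  "tP = [:0, 1:]"


section \<open>The step polynomial and the kernel polynomial\<close>

text \<open>
  The Laurent polynomial with support \<open>A\<close> and coefficients \<open>w\<close>, evaluated at a pair of
  elements of a field into which the complex numbers are mapped by \<open>emb\<close>.
\<close>

definition laurent_eval ::
    "(complex \<Rightarrow> 'k::field) \<Rightarrow> (int \<times> int) set \<Rightarrow> (int \<times> int \<Rightarrow> complex) \<Rightarrow> 'k \<Rightarrow> 'k \<Rightarrow> 'k" where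
  "laurent_eval emb A w u v = (\<Sum>s\<in>A. emb (w s) * u powi fst s * v powi snd s)"

abbreviation S_eval ::
    "(int \<times> int) set \<Rightarrow> (int \<times> int \<Rightarrow> complex) \<Rightarrow> KK \<Rightarrow> KK \<Rightarrow> KK" where
  "S_eval \<equiv> laurent_eval cK"

definition not_univariate :: "(int \<times> int) set \<Rightarrow> bool" where
  "not_univariate A \<longleftrightarrow> (\<exists>s\<in>A. fst s \<noteq> 0) \<and> (\<exists>s\<in>A. snd s \<noteq> 0)"

definition m_x :: "(int \<times> int) set \<Rightarrow> int" where
  "m_x A = max 0 (- Min (fst ` A))"

definition m_y :: "(int \<times> int) set \<Rightarrow> int" where
  "m_y A = max 0 (- Min (snd ` A))"

text \<open>
  The product of \<open>X^m_x Y^m_y\<close> and \<open>1 - t S(X,Y)\<close>, expanded so that it is visibly a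
  polynomial; the lemma below confirms the factored form in the fraction field.
\<close>

definition kernel_poly :: "(int \<times> int) set \<Rightarrow> (int \<times> int \<Rightarrow> complex) \<Rightarrow> pol3" where
  "kernel_poly A w =
     XP ^ nat (m_x A) * YP ^ nat (m_y A)
     - tP * (\<Sum>s\<in>A. cP (w s) * XP ^ nat (m_x A + fst s) * YP ^ nat (m_y A + snd s))"

lemma to_fract_power: "to_fract (p ^ n) = to_fract p ^ n"
  by (induction n) simp_all

lemma to_fract_sum: "to_fract (\<Sum>i\<in>I. f i) = (\<Sum>i\<in>I. to_fract (f i))"
  by (induction I rule: infinite_finite_induct) simp_all

lemma power_nat_conv_powi:
  fixes a :: "'k::field"
  assumes "a \<noteq> 0" "m + n \<ge> 0" "m \<ge> 0"
  shows "a ^ nat (m + n) = a ^ nat m * a powi n"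
proof -
  have "a ^ nat (m + n) = a powi (m + n)" and "a ^ nat m = a powi m"
    using assms by (simp_all add: power_int_def)
  then show ?thesis
    using assms(1) by (simp add: power_int_add)
qed

lemma kernel_poly_factored:
  assumes "finite A"
  shows "to_fract (kernel_poly A w) =
    to_fract XP ^ nat (m_x A) * to_fract YP ^ nat (m_y A) *
      (1 - to_fract tP * laurent_eval (\<lambda>a. to_fract (cP a)) A w (to_fract XP) (to_fract YP))"
proof -
  have nz: "to_fract XP \<noteq> 0" "to_fract YP \<noteq> 0"
    by (simp_all add: XP_def YP_def)
  have mx: "m_x A + fst s \<ge> 0" and my: "m_y A + snd s \<ge> 0" if "s \<in> A" for s
  proof -
    have "Min (fst ` A) \<le> fst s" "Min (snd ` A) \<le> snd s"
      using assms that by auto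
    then show "m_x A + fst s \<ge> 0" "m_y A + snd s \<ge> 0"
      by (simp_all add: m_x_def m_y_def)
  qed
  have m0: "m_x A \<ge> 0" "m_y A \<ge> 0"
    by (simp_all add: m_x_def m_y_def)
  let ?X = "to_fract XP" and ?Y = "to_fract YP" and ?t = "to_fract tP"
  let ?M = "?X ^ nat (m_x A) * ?Y ^ nat (m_y A)"
  have "(\<Sum>s\<in>A. to_fract (cP (w s)) * ?X ^ nat (m_x A + fst s) * ?Y ^ nat (m_y A + snd s)) =
      ?M * laurent_eval (\<lambda>a. to_fract (cP a)) A w ?X ?Y"
    unfolding laurent_eval_def sum_distrib_left
    by (intro sum.cong refl)
      (simp only: power_nat_conv_powi[OF nz(1) mx m0(1)] power_nat_conv_powi[OF nz(2) my m0(2)] mult_ac)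
  then show ?thesis
    unfolding kernel_poly_def to_fract_diff to_fract_mult to_fract_power to_fract_sum
    by (simp add: right_diff_distrib mult_ac)
qed


section \<open>The orbit\<close>

text \<open>
  The Laurent polynomial has a value at \<open>(u, v)\<close> only if no negative power of zero occurs.
  The guard is needed since \<open>0 powi n = 0\<close> for negative \<open>n\<close>.
\<close>

definition S_defined :: "(int \<times> int) set \<Rightarrow> KK \<times> KK \<Rightarrow> bool" where
  "S_defined A p \<longleftrightarrow>
     (fst p = 0 \<longrightarrow> (\<forall>s\<in>A. fst s \<ge> 0)) \<and> (snd p = 0 \<longrightarrow> (\<forall>s\<in>A. snd s \<ge> 0))"

definition adjacent ::
    "(int \<times> int) set \<Rightarrow> (int \<times> int \<Rightarrow> complex) \<Rightarrow> KK \<times> KK \<Rightarrow> KK \<times> KK \<Rightarrow> bool" where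
  "adjacent A w p q \<longleftrightarrow>
     S_defined A p \<and> S_defined A q \<and>
     S_eval A w (fst p) (snd p) = S_eval A w (fst q) (snd q) \<and>
     (fst p = fst q \<or> snd p = snd q)"

definition orbit :: "(int \<times> int) set \<Rightarrow> (int \<times> int \<Rightarrow> complex) \<Rightarrow> (KK \<times> KK) set" where
  "orbit A w = {p. (adjacent A w)\<^sup>+\<^sup>+ p (xK, yK)}"


section \<open>The fields generated over \<open>k\<close> by the coordinates of the base point\<close>

definition k_field :: "(int \<times> int) set \<Rightarrow> (int \<times> int \<Rightarrow> complex) \<Rightarrow> KK set" where
  "k_field A w = generate_field ring_of_type_algebra (range cK \<union> {S_eval A w xK yK})"

definition kx_field :: "(int \<times> int) set \<Rightarrow> (int \<times> int \<Rightarrow> complex) \<Rightarrow> KK set" where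
  "kx_field A w = generate_field ring_of_type_algebra (k_field A w \<union> {xK})"

definition ky_field :: "(int \<times> int) set \<Rightarrow> (int \<times> int \<Rightarrow> complex) \<Rightarrow> KK set" where
  "ky_field A w = generate_field ring_of_type_algebra (k_field A w \<union> {yK})"


section \<open>Regular fractions and their evaluation\<close>

text \<open>\<^const>\<open>quot_of_fract\<close> returns numerator and denominator in lowest terms.\<close>

definition regular :: "(int \<times> int) set \<Rightarrow> (int \<times> int \<Rightarrow> complex) \<Rightarrow> frac3 \<Rightarrow> bool" where
  "regular A w H \<longleftrightarrow> \<not> kernel_poly A w dvd snd (quot_of_fract H)"

definition poly3_eval :: "pol3 \<Rightarrow> KK \<Rightarrow> KK \<Rightarrow> KK \<Rightarrow> KK" where
  "poly3_eval P u v z =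
     poly (map_poly (\<lambda>q. poly (map_poly (\<lambda>r. poly (map_poly cK r) u) q) v) P) z"

definition frac3_eval :: "frac3 \<Rightarrow> KK \<Rightarrow> KK \<Rightarrow> KK \<Rightarrow> KK" where
  "frac3_eval H u v z =
     poly3_eval (fst (quot_of_fract H)) u v z / poly3_eval (snd (quot_of_fract H)) u v z"

definition eval_at ::
    "(int \<times> int) set \<Rightarrow> (int \<times> int \<Rightarrow> complex) \<Rightarrow> frac3 \<Rightarrow> KK \<times> KK \<Rightarrow> KK" where
  "eval_at A w H p = frac3_eval H (fst p) (snd p) (1 / S_eval A w xK yK)"


section \<open>Zero-chains\<close>

text \<open>
  A \<open>0\<close>-chain is a finitely supported function from pairs to complex coefficients whose
  support lies in the orbit.
\<close>

type_synonym chain = "(KK \<times> KK) \<Rightarrow>\<^sub>0 complex"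

definition zero_chain :: "(int \<times> int) set \<Rightarrow> (int \<times> int \<Rightarrow> complex) \<Rightarrow> chain \<Rightarrow> bool" where
  "zero_chain A w c \<longleftrightarrow> Poly_Mapping.keys c \<subseteq> orbit A w"

definition eval_chain ::
    "(int \<times> int) set \<Rightarrow> (int \<times> int \<Rightarrow> complex) \<Rightarrow> frac3 \<Rightarrow> chain \<Rightarrow> KK" where
  "eval_chain A w H c = (\<Sum>p\<in>Poly_Mapping.keys c. cK (Poly_Mapping.lookup c p) * eval_at A w H p)"


section \<open>Decouplings\<close>

text \<open>The subfields of fractions in \<open>X, t\<close> only, and in \<open>Y, t\<close> only.\<close>

definition frac_Xt :: "frac3 set" where
  "frac_Xt = generate_field ring_of_type_algebra
     (range (\<lambda>a. to_fract (cP a)) \<union> {to_fract XP, to_fract tP})"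

definition frac_Yt :: "frac3 set" where
  "frac_Yt = generate_field ring_of_type_algebra
     (range (\<lambda>a. to_fract (cP a)) \<union> {to_fract YP, to_fract tP})"

definition galois_decoupling ::
    "(int \<times> int) set \<Rightarrow> (int \<times> int \<Rightarrow> complex) \<Rightarrow> frac3 \<Rightarrow> bool" where
  "galois_decoupling A w H \<longleftrightarrow>
     (\<exists>F\<in>frac_Xt. \<exists>G\<in>frac_Yt.
        eval_at A w H (xK, yK) = eval_at A w F (xK, yK) + eval_at A w G (xK, yK))"

definition orbit_decoupling ::
    "(int \<times> int) set \<Rightarrow> (int \<times> int \<Rightarrow> complex) \<Rightarrow> chain \<Rightarrow> chain \<Rightarrow> chain \<Rightarrow> bool" where
  "orbit_decoupling A w \<gamma>x \<gamma>y \<alpha> \<longleftrightarrow>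
     zero_chain A w \<gamma>x \<and> zero_chain A w \<gamma>y \<and> zero_chain A w \<alpha> \<and>
     Poly_Mapping.single (xK, yK) 1 = \<gamma>x + \<gamma>y + \<alpha> \<and>
     (\<forall>H. regular A w H \<longrightarrow>
        eval_chain A w H \<gamma>x \<in> kx_field A w \<and>
        eval_chain A w H \<gamma>y \<in> ky_field A w \<and>
        (galois_decoupling A w H \<longrightarrow> eval_chain A w H \<alpha> = 0))"

end

theory Submission
  imports Defs
begin

text \<open>
  Evaluation is additive in the chain, so the identity \<open>(x,y) = \<gamma>x + \<gamma>y + \<alpha>\<close> yields
  \<open>H(x,y) = H(\<gamma>x) + H(\<gamma>y) + H(\<alpha>)\<close>. If \<open>H(\<alpha>) = 0\<close>, then \<open>H(x,y)\<close> is the sum of an element of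
  \<open>k(x)\<close> and an element of \<open>k(y)\<close>, and these lift to \<open>\<complex>(X,t)\<close> and \<open>\<complex>(Y,t)\<close> because
  the values \<open>P(x,y,1/S)/Q(x,y,1/S)\<close> with \<open>P/Q\<close> in \<open>\<complex>(X,t)\<close> form a field containing \<open>\<complex>\<close>, \<open>S\<close>
  and \<open>x\<close>.
\<close>

section \<open>Generated subfields in terms of type-class operations\<close>

text \<open>The inverse of the ring record is given by a description; uniqueness of inverses
  identifies it with the class operation.\<close>

lemma inv_ring_of_type_algebra:
  fixes a :: "'a::field"
  assumes "a \<noteq> 0"
  shows "inv\<^bsub>ring_of_type_algebra\<^esub> a = inverse a"
proof -
  interpret field "ring_of_type_algebra :: 'a ring"
    by standard
  show ?thesis
    using assms by (intro comm_inv_char) (auto simp: ring_of_type_algebra_def)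
qed

lemma a_inv_ring_of_type_algebra:
  fixes a :: "'a::field"
  shows "\<ominus>\<^bsub>ring_of_type_algebra\<^esub> a = - a"
proof -
  interpret field "ring_of_type_algebra :: 'a ring"
    by standard
  show ?thesis
    by (intro minus_equality) (auto simp: ring_of_type_algebra_def)
qed

lemma generate_field_type_subset:
  fixes T :: "'a::field set"
  assumes "1 \<in> T" "B \<subseteq> T"
    and "\<And>a. a \<in> T \<Longrightarrow> - a \<in> T"
    and "\<And>a. a \<in> T \<Longrightarrow> a \<noteq> 0 \<Longrightarrow> inverse a \<in> T"
    and "\<And>a b. a \<in> T \<Longrightarrow> b \<in> T \<Longrightarrow> a + b \<in> T"
    and "\<And>a b. a \<in> T \<Longrightarrow> b \<in> T \<Longrightarrow> a * b \<in> T"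
  shows "generate_field ring_of_type_algebra B \<subseteq> T"
proof
  fix z
  assume "z \<in> generate_field ring_of_type_algebra B"
  then show "z \<in> T"
  proof induction
    case (a_inv h)
    then show ?case using assms(3) by (simp add: a_inv_ring_of_type_algebra)
  next
    case (m_inv h)
    then have "h \<noteq> 0" by (simp add: ring_of_type_algebra_def)
    with m_inv.IH show ?case using assms(4) by (simp add: inv_ring_of_type_algebra)
  qed (use assms in \<open>auto simp: ring_of_type_algebra_def\<close>)
qed

lemma generate_field_type_closed:
  fixes B :: "'a::field set"
  defines "F \<equiv> generate_field ring_of_type_algebra B"
  shows "1 \<in> F"
    and "a \<in> F \<Longrightarrow> - a \<in> F"
    and "a \<in> F \<Longrightarrow> inverse a \<in> F"
    and "a \<in> F \<Longrightarrow> b \<in> F \<Longrightarrow> a + b \<in> F"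
    and "a \<in> F \<Longrightarrow> b \<in> F \<Longrightarrow> a * b \<in> F"
proof -
  show "1 \<in> F"
    using generate_field.one[of ring_of_type_algebra B]
    by (simp add: F_def ring_of_type_algebra_def)
  show "a \<in> F \<Longrightarrow> - a \<in> F"
    using generate_field.a_inv[of a ring_of_type_algebra B] by (simp add: F_def a_inv_ring_of_type_algebra)
  show "a \<in> F \<Longrightarrow> inverse a \<in> F"
    using generate_field.m_inv[of a ring_of_type_algebra B] inv_ring_of_type_algebra[of a]
    \<comment> \<open>For \<open>a = 0\<close> the convention \<open>inverse 0 = 0\<close> reduces
      the claim to \<open>a \<in> F\<close>.\<close>
    by (cases "a = 0") (auto simp: F_def ring_of_type_algebra_def)
  show "a \<in> F \<Longrightarrow> b \<in> F \<Longrightarrow> a + b \<in> F"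
    using generate_field.eng_add[of a ring_of_type_algebra B b]
    by (simp add: F_def ring_of_type_algebra_def)
  show "a \<in> F \<Longrightarrow> b \<in> F \<Longrightarrow> a * b \<in> F"
    using generate_field.eng_mult[of a ring_of_type_algebra B b]
    by (simp add: F_def ring_of_type_algebra_def)
qed

section \<open>Evaluation as a ring homomorphism\<close>

definition ring_map :: "('a::comm_ring_1 \<Rightarrow> 'b::comm_ring_1) \<Rightarrow> bool" where
  "ring_map h \<longleftrightarrow> h 1 = 1 \<and> (\<forall>a b. h (a + b) = h a + h b) \<and> (\<forall>a b. h (a * b) = h a * h b)"

lemma ring_mapD:
  assumes "ring_map h"
  shows "h 1 = 1" "h (a + b) = h a + h b" "h (a * b) = h a * h b" "h 0 = 0" "h (- a) = - h a"
proof -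
  have add: "h (a + b) = h a + h b" for a b
    using assms by (simp add: ring_map_def)
  show zero: "h 0 = 0"
    using add[of 0 0] by simp
  show "h (- a) = - h a"
    using add[of a "- a"] zero by (simp add: eq_neg_iff_add_eq_0 add.commute)
qed (use assms in \<open>auto simp: ring_map_def\<close>)

text \<open>A homomorphism on coefficients extends to polynomials by sending the variable to
  \<open>u\<close>. Three such extensions of \<open>cK\<close>, one for each of X, Y and t, compose
  to \<open>poly3_eval\<close>.\<close>

lemma ring_map_poly_eval:
  assumes "ring_map f"
  shows "ring_map (\<lambda>p. poly (map_poly f p) u)"
proof -
  note f = ring_mapD[OF assms]
  have add: "poly (map_poly f (p + q)) u = poly (map_poly f p) u + poly (map_poly f q) u" for p q
    by (induction p q rule: poly_induct2) (simp_all add: map_poly_pCons f algebra_simps)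
  have smult: "poly (map_poly f (smult c p)) u = f c * poly (map_poly f p) u" for c p
    by (simp add: map_poly_smult f)
  \<comment> \<open>Splitting off the constant coefficient of \<open>p\<close> leaves a scalar
    multiple of \<open>q\<close> and a shifted product, so \<open>add\<close> and
    \<open>smult\<close> suffice.\<close>
  have mult: "poly (map_poly f (p * q)) u = poly (map_poly f p) u * poly (map_poly f q) u" for p q
    by (induction p) (simp_all add: map_poly_pCons f add smult algebra_simps)
  show ?thesis
    by (simp add: ring_map_def f add mult)
qed

lemma ring_map_cK: "ring_map cK"
  by (simp add: ring_map_def cK_def one_pCons [symmetric]
      flip: to_ac_add to_ac_mult to_fract_add to_fract_mult)

lemma ring_map_poly3_eval: "ring_map (\<lambda>P. poly3_eval P u v z)"
  unfolding poly3_eval_def by (intro ring_map_poly_eval ring_map_cK)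

lemma poly3_eval_gens:
  "poly3_eval (cP a) u v z = cK a"
  "poly3_eval XP u v z = u"
  "poly3_eval YP u v z = v"
  "poly3_eval tP u v z = z"
  using ring_mapD(1,4)[OF ring_map_cK]
  by (simp_all add: poly3_eval_def cP_def XP_def YP_def tP_def map_poly_pCons)

text \<open>
  Passing to lowest terms is harmless: the reduced denominator divides \<open>Q\<close>, hence does not
  vanish at the point either.
\<close>

lemma frac3_eval_divide:
  assumes "poly3_eval Q u v z \<noteq> 0"
  shows "frac3_eval (to_fract P / to_fract Q) u v z = poly3_eval P u v z / poly3_eval Q u v z"
proof -
  note h = ring_mapD[OF ring_map_poly3_eval[of u v z]]
  define H where "H = to_fract P / to_fract Q"
  define N where "N = fst (quot_of_fract H)"
  define D where "D = snd (quot_of_fract H)"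
  have "Q \<noteq> 0" using assms h(4) by auto
  have "D \<noteq> 0" by (simp add: D_def)
  have "Fract N D = Fract P Q"
    unfolding N_def D_def Fract_quot_of_fract by (simp add: H_def Fract_conv_to_fract)
  then have eq: "N * Q = P * D"
    using \<open>Q \<noteq> 0\<close> \<open>D \<noteq> 0\<close> by (simp add: eq_fract)
  have "coprime D N"
    unfolding N_def D_def by (simp add: coprime_commute coprime_quot_of_fract)
  moreover have "D dvd N * Q"
    by (simp add: eq)
  ultimately have "D dvd Q"
    by (simp add: coprime_dvd_mult_right_iff)
  then obtain R where "Q = D * R" ..
  then have "poly3_eval D u v z \<noteq> 0"
    using assms h(3) by auto
  moreover have "poly3_eval N u v z * poly3_eval Q u v z = poly3_eval P u v z * poly3_eval D u v z"
    using eq h(3) by metis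
  ultimately have "poly3_eval N u v z / poly3_eval D u v z = poly3_eval P u v z / poly3_eval Q u v z"
    using assms by (simp add: frac_eq_eq)
  then show ?thesis
    by (simp add: frac3_eval_def H_def N_def D_def)
qed

section \<open>Values of fractions and lifting from k(x) and k(y)\<close>

text \<open>As \<open>h\<close> may have a kernel, it need not extend to all fractions; hence only
  quotients whose denominator survives under \<open>h\<close> are taken.\<close>

definition fraction_values :: "('a::idom \<Rightarrow> 'b::field) \<Rightarrow> 'a fract set \<Rightarrow> 'b set" where
  "fraction_values h F = {h P / h Q | P Q. to_fract P \<in> F \<and> to_fract Q \<in> F \<and> h Q \<noteq> 0}"

lemma fraction_valuesI:
  "to_fract P \<in> F \<Longrightarrow> to_fract Q \<in> F \<Longrightarrow> h Q \<noteq> 0 \<Longrightarrow> h P / h Q \<in> fraction_values h F"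
  by (auto simp: fraction_values_def)

lemma fraction_valuesE:
  assumes "a \<in> fraction_values h F"
  obtains P Q where "to_fract P \<in> F" "to_fract Q \<in> F" "h Q \<noteq> 0" "a = h P / h Q"
  using assms by (auto simp: fraction_values_def)

text \<open>The values form a field: common denominators give sums and products, and
  \<open>h Q * h Q'\<close> is nonzero in a field. So checking the generators is enough.\<close>

lemma generate_field_subset_fraction_values:
  fixes h :: "'a::idom \<Rightarrow> 'b::field" and B :: "'a fract set"
  defines "F \<equiv> generate_field ring_of_type_algebra B"
  assumes "ring_map h" and G: "G \<subseteq> fraction_values h F"
  shows "generate_field ring_of_type_algebra G \<subseteq> fraction_values h F"
proof (rule generate_field_type_subset)
  note h = ring_mapD[OF \<open>ring_map h\<close>]
  note F = generate_field_type_closed[where B = B, folded F_def]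
  show "1 \<in> fraction_values h F"
    using fraction_valuesI[of 1 F 1 h] F(1) h(1) by simp
  show "G \<subseteq> fraction_values h F" by (rule G)
  fix a assume "a \<in> fraction_values h F"
  then obtain P Q where PQ: "to_fract P \<in> F" "to_fract Q \<in> F" "h Q \<noteq> 0" "a = h P / h Q"
    by (rule fraction_valuesE)
  show "- a \<in> fraction_values h F"
    using fraction_valuesI[of "- P" F Q h] PQ F(2) h(5) by simp
  \<comment> \<open>Numerator and denominator can be swapped, because \<open>a \<noteq> 0\<close>
    forces \<open>h P \<noteq> 0\<close>.\<close>
  show "inverse a \<in> fraction_values h F" if "a \<noteq> 0"
    using fraction_valuesI[of Q F P h] PQ that by auto
  fix b assume "b \<in> fraction_values h F"
  then obtain P' Q' where PQ': "to_fract P' \<in> F" "to_fract Q' \<in> F" "h Q' \<noteq> 0" "b = h P' / h Q'"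
    by (rule fraction_valuesE)
  show "a + b \<in> fraction_values h F"
    using fraction_valuesI[of "P * Q' + P' * Q" F "Q * Q'" h] PQ PQ' F(4,5) h(2,3)
    by (simp add: add_frac_eq)
  show "a * b \<in> fraction_values h F"
    using fraction_valuesI[of "P * P'" F "Q * Q'" h] PQ PQ' F(5) h(3) by simp
qed

text \<open>Treats k(x) and k(y) at once, with \<open>V\<close> being \<open>XP\<close> or
  \<open>YP\<close>. Constants are values of constants, S(x,y) is the value of 1/t, and
  \<open>a\<close> is the value of \<open>V\<close>, so every element of k(a) is a value.\<close>

lemma generate_field_lift:
  fixes V :: pol3 and a :: KK
  defines "F \<equiv> generate_field ring_of_type_algebra
     (range (\<lambda>a. to_fract (cP a)) \<union> {to_fract V, to_fract tP})"
  assumes V: "poly3_eval V xK yK (1 / S_eval A w xK yK) = a"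
    and z: "z \<in> generate_field ring_of_type_algebra (k_field A w \<union> {a})"
  obtains f where "f \<in> F" "eval_at A w f (xK, yK) = z"
proof -
  let ?S = "S_eval A w xK yK"
  let ?h = "\<lambda>P. poly3_eval P xK yK (1 / ?S)"
  note h = ring_map_poly3_eval[of xK yK "1 / ?S"]
  note F = generate_field_type_closed
    [where B = "range (\<lambda>a. to_fract (cP a)) \<union> {to_fract V, to_fract tP}", folded F_def]
  have gens: "to_fract (cP c) \<in> F" "to_fract V \<in> F" "to_fract tP \<in> F" for c
    by (auto simp: F_def intro: generate_field.incl)
  have val: "?h P \<in> fraction_values ?h F" if "to_fract P \<in> F" for P
    using fraction_valuesI[of P F 1 ?h] that F(1) ring_mapD(1)[OF h] by simp
  have "cK c \<in> fraction_values ?h F" for c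
    using val[OF gens(1)] by (simp add: poly3_eval_gens)
  moreover have "?S \<in> fraction_values ?h F"
  \<comment> \<open>If S(x,y) were 0, then \<open>1 / 0 = 0\<close> would make \<open>tP\<close>
    itself take the value S(x,y); otherwise the quotient of 1 by \<open>tP\<close> does.\<close>
  proof (cases "?S = 0")
    case True
    then show ?thesis
      using val[OF gens(3)] by (simp add: poly3_eval_gens)
  next
    case False
    then show ?thesis
      using fraction_valuesI[of 1 F tP ?h] F(1) gens(3) ring_mapD(1)[OF h]
      by (simp add: poly3_eval_gens)
  qed
  ultimately have "k_field A w \<subseteq> fraction_values ?h F"
    unfolding k_field_def F_def using h
    by (intro generate_field_subset_fraction_values) auto
  moreover have "a \<in> fraction_values ?h F"
    using val[OF gens(2)] V by simp
  \<comment> \<open>The closure lemma is applied a second time, now with all of k and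
    \<open>a\<close> as generators.\<close>
  ultimately have "z \<in> fraction_values ?h F"
    using z generate_field_subset_fraction_values[OF h, of "k_field A w \<union> {a}"]
    unfolding F_def by blast
  then obtain P Q where PQ: "to_fract P \<in> F" "to_fract Q \<in> F" "?h Q \<noteq> 0" "z = ?h P / ?h Q"
    by (rule fraction_valuesE)
  show thesis
  proof
    show "to_fract P / to_fract Q \<in> F"
      using PQ F(3,5) by (simp add: divide_inverse)
    show "eval_at A w (to_fract P / to_fract Q) (xK, yK) = z"
      using PQ by (simp add: eval_at_def frac3_eval_divide)
  qed
qed

lemma kx_field_lift:
  assumes "z \<in> kx_field A w"
  obtains f where "f \<in> frac_Xt" "eval_at A w f (xK, yK) = z"
  using assms generate_field_lift[OF poly3_eval_gens(2)] unfolding kx_field_def frac_Xt_def by metis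

lemma ky_field_lift:
  assumes "z \<in> ky_field A w"
  obtains g where "g \<in> frac_Yt" "eval_at A w g (xK, yK) = z"
  using assms generate_field_lift[OF poly3_eval_gens(3)] unfolding ky_field_def frac_Yt_def by metis

section \<open>Evaluation on chains and the equivalence\<close>

text \<open>Cancellation may shrink the support of \<open>c + d\<close>, but a pair with coefficient
  0 contributes 0, and each summand is additive in its coefficient because \<open>cK\<close>
  is.\<close>

lemma eval_chain_add: "eval_chain A w H (c + d) = eval_chain A w H c + eval_chain A w H d"
  unfolding eval_chain_def
  by (rule setsum_keys_plus_distrib)
    (simp_all add: ring_mapD[OF ring_map_cK] distrib_right)

lemma eval_chain_single: "eval_chain A w H (Poly_Mapping.single p 1) = eval_at A w H p"
  by (simp add: eval_chain_def ring_mapD[OF ring_map_cK])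

theorem proposition22:
  fixes A :: "(int \<times> int) set" and w :: "int \<times> int \<Rightarrow> complex"
    and \<gamma>x \<gamma>y \<alpha> :: chain and H :: frac3
  assumes "finite A"
    and "\<And>s. s \<in> A \<Longrightarrow> w s \<noteq> 0"
    and "not_univariate A"
    and "finite (orbit A w)"
    and "orbit_decoupling A w \<gamma>x \<gamma>y \<alpha>"
    and "regular A w H"
  shows "(galois_decoupling A w H \<longleftrightarrow> eval_chain A w H \<alpha> = 0) \<and>
    (galois_decoupling A w H \<longrightarrow>
       eval_at A w H (xK, yK) = eval_chain A w H \<gamma>x + eval_chain A w H \<gamma>y \<and>
       eval_chain A w H \<gamma>x \<in> kx_field A w \<and>
       eval_chain A w H \<gamma>y \<in> ky_field A w)"
proof -
  have \<gamma>x: "eval_chain A w H \<gamma>x \<in> kx_field A w"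
    and \<gamma>y: "eval_chain A w H \<gamma>y \<in> ky_field A w"
    and \<alpha>: "galois_decoupling A w H \<Longrightarrow> eval_chain A w H \<alpha> = 0"
    and sum: "Poly_Mapping.single (xK, yK) 1 = \<gamma>x + \<gamma>y + \<alpha>"
    using assms(5,6) by (simp_all add: orbit_decoupling_def)
  have eval: "eval_at A w H (xK, yK) =
      eval_chain A w H \<gamma>x + eval_chain A w H \<gamma>y + eval_chain A w H \<alpha>"
    using sum by (metis eval_chain_add eval_chain_single)
  \<comment> \<open>The other implication is a clause of \<open>orbit_decoupling\<close>; this one
    needs the lifts.\<close>
  have "galois_decoupling A w H" if "eval_chain A w H \<alpha> = 0"
  proof -
    obtain f where "f \<in> frac_Xt" "eval_at A w f (xK, yK) = eval_chain A w H \<gamma>x"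
      using \<gamma>x by (rule kx_field_lift)
    moreover obtain g where "g \<in> frac_Yt" "eval_at A w g (xK, yK) = eval_chain A w H \<gamma>y"
      using \<gamma>y by (rule ky_field_lift)
    ultimately show ?thesis
      using eval that unfolding galois_decoupling_def by force
  qed
  then show ?thesis
    using \<alpha> eval \<gamma>x \<gamma>y by auto
qed

end
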